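(* Let $f\in C^\infty(\mathbb{R},\mathbb{R})$, let $\alpha\in(0,1]$, and let $a$ satisfy condition (A) of the context. Suppose that there exists $\delta>0$ such that $a(x)\ge\delta$ for all $x\in\mathbb{T}$. Let $u_0\in L^\infty(\mathbb{T})$. Then there exists $T>0$ such that the solution $u$ of $$\partial_t u+\partial_x(f(u))+a(x)\frac{u}{|u|^\alpha}=0\quad\text{in }\mathbb{R}_+\times\mathbb{T},\qquad u_{|t=0}=u_0,$$ satisfies $$u(t,x)=0\quad\text{for all }t\ge T\text{ and a.e. }x\in\mathbb{T}.$$ Besides, this holds with $T=\frac{1}{\alpha\delta}\|u_0\|_{L^\infty(\mathbb{T})}^\alpha$.
   Context: $\mathbb{T}=\mathbb{R}/\mathbb{Z}$, $\mathbb{R}_+=[0,\infty)$. Condition (A) on $a:\mathbb{T}\to\mathbb{R}$: $a(x)\ge 0$ for all $x\in\mathbb{T}$, $a\in L^\infty(\mathbb{T})$, and $\sup_{y>0}\frac1y\int_{\mathbb{T}}|a(x+y)-a(x)|\,dx<\infty$. $\mathrm{Sign}(u)=\{1\}$ if $u>0$, $\{-1\}$ if $u<0$, $[-1,1]$ if $u=0$. For $\alpha<1$, $u/|u|^\alpha$ is understood as $0$ at $u=0$. Admissible weak solution on $[0,T]\times\mathbb{T}$ with initial datum $u_0\in L^\infty(\mathbb{T})$: (Case $0<\alpha<1$.) A bounded measurable function $u$ on $[0,T]\times\mathbb{T}$ such that, with $h(t,x)=a(x)\frac{u(t,x)}{|u(t,x)|^\alpha}$, $$\int_0^T\!\!\int_{\mathbb{T}}\big(\partial_t\psi\,\eta(u)+\partial_x\psi\,q(u)-\psi\,\eta'(u)\,h\big)\,dx\,dt+\int_{\mathbb{T}}\psi(0,x)\eta(u_0(x))\,dx\ge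 0\qquad( * )$$ for every convex (hence locally Lipschitz) function $\eta:\mathbb{R}\to\mathbb{R}$, with $q$ such that $q'=f'\eta'$, and every nonnegative Lipschitz continuous $\psi$ on $[0,T]\times\mathbb{T}$ with $\psi(T,\cdot)=0$. At points where $\eta$ is not differentiable, $\eta'$ denotes the average of the left and right derivatives. (Case $\alpha=1$.) A bounded measurable function $u$ on $[0,T]\times\mathbb{T}$ for which there exists $h\in L^\infty((0,T)\times\mathbb{T})$ with $\partial_t u+\partial_x(f(u))+h=0$ in $\mathscr{D}'((0,T)\times\mathbb{T})$, $h(t,x)\in a(x)\,\mathrm{Sign}(u(t,x))$ for a.e. $(t,x)\in(0,T)\times\mathbb{T}$, and such that $( * )$ holds with this $h$ for every convex (hence locally Lipschitz) function $\eta:\mathbb{R}\to\mathbb{R}$, with $q$ such that $q'=f'\eta'$, and every nonnegative Lipschitz continuous $\psi$ on $[0,T]\times\mathbb{T}$ with $\psi(T,\cdot)=0$ (with $\eta'$ again denoting the average of the left and right derivatives at points where $\eta$ is not differentiable). "The solution" means the global admissible weak solution (admissible weak solution on $[0,T]\times\mathbb{T}$ for every $T>0$), which exists, is unique, and is taken in its $C^0(\mathbb{R}_+;L^1(\mathbb{T}))$ representative, so that $u(t)$ makes sense for every $t\ge 0$. *)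

theory Defs
  imports "HOL-Analysis.Analysis" "HOL-Probability.Essential_Supremum" "HOL-Library.Periodic_Fun"
begin

text \<open>
  Functions on the torus \<open>\<real>/\<int>\<close> are encoded as 1-periodic functions on the real line and are
  integrated over the fundamental domain \<open>[0,1)\<close>.
\<close>

abbreviation periodic1 :: "(real \<Rightarrow> real) \<Rightarrow> bool" where
  "periodic1 g \<equiv> periodic_fun_simple' g"

definition torus :: "real measure" where
  "torus = lebesgue_on {0..<1}"

definition strip :: "real \<Rightarrow> (real \<times> real) measure" where
  "strip T = lebesgue_on ({0..T} \<times> {0..<1})"

definition Linf_torus :: "(real \<Rightarrow> real) \<Rightarrow> bool" where
  "Linf_torus g \<longleftrightarrow> periodic1 g \<and> g \<in> borel_measurable torus \<and> (\<exists>C. AE x in torus. \<bar>g x\<bar> \<le> C)"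

definition Linf_norm :: "(real \<Rightarrow> real) \<Rightarrow> real" where
  "Linf_norm g = real_of_ereal (esssup torus (\<lambda>x. ereal \<bar>g x\<bar>))"

definition Linf_strip :: "real \<Rightarrow> (real \<Rightarrow> real \<Rightarrow> real) \<Rightarrow> bool" where
  "Linf_strip T h \<longleftrightarrow>
     (\<forall>t\<in>{0<..<T}. periodic1 (h t)) \<and>
     (\<lambda>(t, x). h t x) \<in> borel_measurable (strip T) \<and>
     (\<exists>C. AE (t, x) in strip T. \<bar>h t x\<bar> \<le> C)"

definition bounded_measurable_strip :: "real \<Rightarrow> (real \<Rightarrow> real \<Rightarrow> real) \<Rightarrow> bool" where
  "bounded_measurable_strip T u \<longleftrightarrow>
     (\<forall>t\<in>{0..T}. periodic1 (u t)) \<and>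
     (\<lambda>(t, x). u t x) \<in> borel_measurable (strip T) \<and>
     (\<exists>C. \<forall>t\<in>{0..T}. \<forall>x. \<bar>u t x\<bar> \<le> C)"

definition condition_A :: "(real \<Rightarrow> real) \<Rightarrow> bool" where
  "condition_A a \<longleftrightarrow>
     (\<forall>x. 0 \<le> a x) \<and> Linf_torus a \<and>
     bdd_above ((\<lambda>y. 1 / y * (LINT x|torus. \<bar>a (x + y) - a x\<bar>)) ` {0<..})"

definition smooth :: "(real \<Rightarrow> real) \<Rightarrow> bool" where
  "smooth f \<longleftrightarrow> (\<forall>n x. (deriv ^^ n) f differentiable (at x))"

definition Sign :: "real \<Rightarrow> real set" where
  "Sign u = (if u > 0 then {1} else if u < 0 then {-1} else {-1..1})"

definition pd_t :: "(real \<Rightarrow> real \<Rightarrow> real) \<Rightarrow> real \<Rightarrow> real \<Rightarrow> real" where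
  "pd_t \<phi> t x = deriv (\<lambda>s. \<phi> s x) t"

definition pd_x :: "(real \<Rightarrow> real \<Rightarrow> real) \<Rightarrow> real \<Rightarrow> real \<Rightarrow> real" where
  "pd_x \<phi> t x = deriv (\<lambda>y. \<phi> t y) x"

text \<open>
  Smoothness in two variables: every iterated partial derivative (in any order) is Frechet
  differentiable, hence continuous.
\<close>

definition smooth2 :: "(real \<Rightarrow> real \<Rightarrow> real) \<Rightarrow> bool" where
  "smooth2 \<phi> \<longleftrightarrow>
     (\<forall>Ds. set Ds \<subseteq> {pd_t, pd_x} \<longrightarrow>
        (\<forall>z. (\<lambda>(t, x). foldr (\<lambda>D. D) Ds \<phi> t x) differentiable (at z)))"

text \<open>
  Smooth functions with compact support in \<open>(0,T) \<times> \<real>/\<int>\<close>, extended by \<open>0\<close> to all times;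
  since the torus is compact, only the support in time matters.
\<close>

definition test_function :: "real \<Rightarrow> (real \<Rightarrow> real \<Rightarrow> real) \<Rightarrow> bool" where
  "test_function T \<phi> \<longleftrightarrow>
     smooth2 \<phi> \<and> (\<forall>t. periodic1 (\<phi> t)) \<and>
     (\<exists>\<epsilon>>0. \<forall>t x. t \<notin> {\<epsilon>..T - \<epsilon>} \<longrightarrow> \<phi> t x = 0)"

definition distributional_equation ::
    "(real \<Rightarrow> real) \<Rightarrow> real \<Rightarrow> (real \<Rightarrow> real \<Rightarrow> real) \<Rightarrow> (real \<Rightarrow> real \<Rightarrow> real) \<Rightarrow> bool" where
  "distributional_equation f T u h \<longleftrightarrow>
     (\<forall>\<phi>. test_function T \<phi> \<longrightarrow>
        (LINT (t, x)|strip T. - u t x * pd_t \<phi> t x - f (u t x) * pd_x \<phi> t x + h t x * \<phi> t x) = 0)"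

text \<open>
  For convex \<open>\<eta>\<close> both one-sided derivatives exist everywhere; their average is the
  derivative wherever \<open>\<eta>\<close> is differentiable.
\<close>

definition avg_deriv :: "(real \<Rightarrow> real) \<Rightarrow> real \<Rightarrow> real" where
  "avg_deriv \<eta> u =
     (Lim (at_left u) (\<lambda>v. (\<eta> v - \<eta> u) / (v - u)) + Lim (at_right u) (\<lambda>v. (\<eta> v - \<eta> u) / (v - u))) / 2"

text \<open>
  \<open>q' = f' \<eta>'\<close> means that \<open>q\<close> is a primitive of \<open>f' \<eta>'\<close>: at a kink of \<open>\<eta>\<close> the function
  \<open>q\<close> need not be differentiable, so the identity cannot be required pointwise.
\<close>

definition entropy_flux :: "(real \<Rightarrow> real) \<Rightarrow> (real \<Rightarrow> real) \<Rightarrow> (real \<Rightarrow> real) \<Rightarrow> bool" where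
  "entropy_flux f \<eta> q \<longleftrightarrow>
     (\<forall>v w. v \<le> w \<longrightarrow> ((\<lambda>s. deriv f s * avg_deriv \<eta> s) has_integral (q w - q v)) {v..w})"

text \<open>
  The derivatives of a Lipschitz \<open>\<psi>\<close> exist almost everywhere only; \<^const>\<open>deriv\<close> is arbitrary on
  the remaining null set, and so are the values at \<open>t = 0\<close> and \<open>t = T\<close>.
\<close>

definition entropy_inequality ::
    "(real \<Rightarrow> real) \<Rightarrow> (real \<Rightarrow> real) \<Rightarrow> real \<Rightarrow> (real \<Rightarrow> real \<Rightarrow> real) \<Rightarrow> (real \<Rightarrow> real \<Rightarrow> real) \<Rightarrow> bool" where
  "entropy_inequality f u0 T u h \<longleftrightarrow>
     (\<forall>\<eta> q \<psi> C.
        convex_on UNIV \<eta> \<longrightarrow> entropy_flux f \<eta> q \<longrightarrow>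
        (\<forall>t\<in>{0..T}. periodic1 (\<psi> t)) \<longrightarrow>
        C-lipschitz_on ({0..T} \<times> UNIV) (\<lambda>(t, x). \<psi> t x) \<longrightarrow>
        (\<forall>t\<in>{0..T}. \<forall>x. 0 \<le> \<psi> t x) \<longrightarrow> (\<forall>x. \<psi> T x = 0) \<longrightarrow>
        (LINT (t, x)|strip T.
            pd_t \<psi> t x * \<eta> (u t x) + pd_x \<psi> t x * q (u t x) - \<psi> t x * avg_deriv \<eta> (u t x) * h t x)
          + (LINT x|torus. \<psi> 0 x * \<eta> (u0 x)) \<ge> 0)"

text \<open>
  For \<open>\<alpha> < 1\<close> the term \<open>u / \<bar>u\<bar> powr \<alpha>\<close> is \<open>0\<close> at \<open>u = 0\<close> because \<open>0 / 0 = 0\<close> in HOL.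
\<close>

definition admissible_weak_solution ::
    "(real \<Rightarrow> real) \<Rightarrow> real \<Rightarrow> (real \<Rightarrow> real) \<Rightarrow> (real \<Rightarrow> real) \<Rightarrow> real \<Rightarrow> (real \<Rightarrow> real \<Rightarrow> real) \<Rightarrow> bool" where
  "admissible_weak_solution f \<alpha> a u0 T u \<longleftrightarrow>
     bounded_measurable_strip T u \<and>
     (if \<alpha> < 1 then
        entropy_inequality f u0 T u (\<lambda>t x. a x * (u t x / \<bar>u t x\<bar> powr \<alpha>))
      else
        (\<exists>h. Linf_strip T h \<and> distributional_equation f T u h \<and>
             (AE (t, x) in strip T. h t x \<in> (\<lambda>s. a x * s) ` Sign (u t x)) \<and>
             entropy_inequality f u0 T u h))"

definition global_admissible_weak_solution ::
    "(real \<Rightarrow> real) \<Rightarrow> real \<Rightarrow> (real \<Rightarrow> real) \<Rightarrow> (real \<Rightarrow> real) \<Rightarrow> (real \<Rightarrow> real \<Rightarrow> real) \<Rightarrow> bool" where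
  "global_admissible_weak_solution f \<alpha> a u0 u \<longleftrightarrow> (\<forall>T>0. admissible_weak_solution f \<alpha> a u0 T u)"

definition C0_L1 :: "(real \<Rightarrow> real \<Rightarrow> real) \<Rightarrow> bool" where
  "C0_L1 u \<longleftrightarrow>
     (\<forall>t\<ge>0. periodic1 (u t) \<and> integrable torus (u t)) \<and>
     (\<forall>t\<ge>0. ((\<lambda>s. LINT x|torus. \<bar>u s x - u t x\<bar>) \<longlongrightarrow> 0) (at t within {0..}))"

text \<open>
  \<open>u\<close> is the representative in \<open>C\<^sup>0([0,\<infinity>); L\<^sup>1)\<close> of a global admissible weak solution \<open>v\<close>, the
  latter being determined only up to null sets. The equation starts from \<open>u0\<close> through the
  initial term of the entropy inequality.
\<close>

definition is_solution ::
    "(real \<Rightarrow> real) \<Rightarrow> real \<Rightarrow> (real \<Rightarrow> real) \<Rightarrow> (real \<Rightarrow> real) \<Rightarrow> (real \<Rightarrow> real \<Rightarrow> real) \<Rightarrow> bool" where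
  "is_solution f \<alpha> a u0 u \<longleftrightarrow>
     C0_L1 u \<and>
     (\<exists>v. global_admissible_weak_solution f \<alpha> a u0 v \<and>
          (AE t in lebesgue_on {0..}. AE x in torus. u t x = v t x))"

end

theory Submission
  imports Defs
begin

text \<open>
  Along the damping alone, \<open>\<bar>u\<bar> powr \<alpha>\<close> decreases at a rate of at least \<open>\<alpha> \<delta>\<close> until it reaches \<open>0\<close>,
  whence the extinction time. For entropy solutions the same computation is made on a convex
  function of \<open>u\<close>, integrated over the torus. Test functions which depend on time only make the
  flux term vanish. The entropy
    \<open>\<eta> u = u\<^sup>2 * exp (m * \<bar>u\<bar> powr \<alpha>)\<close>
  is continuously differentiable, its derivative is a product of nonnegative increasing factors
  for \<open>u \<ge> 0\<close> and is odd, so \<open>\<eta>\<close> is convex, and the source term \<open>h = a * (u / \<bar>u\<bar> powr \<alpha>)\<close> satisfies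
  \<open>\<eta>' u * h \<ge> m * \<alpha> * \<delta> * \<eta> u\<close> (\<open>damping_entropy_dissipation\<close>). The factor \<open>u\<^sup>2\<close> removes
  the singularity of \<open>\<bar>u\<bar> powr \<alpha>\<close> at \<open>0\<close>; it also makes \<open>\<eta>'\<close> vanish there, so that
  \<open>\<eta>' u * h\<close> is determined on \<open>{u = 0}\<close> even for \<open>\<alpha> = 1\<close>, where \<open>h\<close> is not.

  Testing the entropy inequality with \<open>exp (m * \<alpha> * \<delta> * t) * (S - t)\<close> gives
  (\<open>entropy_decay\<close>)
    \<open>\<integral>\<integral> exp (m * \<alpha> * \<delta> * t) * \<eta> u dx dt \<le> S * \<integral> \<eta> u0 dx \<le> S * M\<^sup>2 * exp (m * M powr \<alpha>)\<close>
  over \<open>[0,S] \<times> \<real>/\<int>\<close>, where \<open>M\<close> is the norm of \<open>u0\<close>. Put \<open>T = M powr \<alpha> / (\<alpha> * \<delta>)\<close>. For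
  \<open>t \<ge> T\<close> the exponential on the left is at least the one on the right; after
  cancelling it, what remains is
    \<open>\<integral>\<integral>\<^bsub>t \<ge> T\<^esub> u\<^sup>2 * exp (m * \<bar>u\<bar> powr \<alpha>) dx dt \<le> S * M\<^sup>2\<close> for every \<open>m > 0\<close>,
  and \<open>m \<rightarrow> \<infinity>\<close> forces \<open>u = 0\<close> almost everywhere for \<open>T \<le> t \<le> S\<close>
  (\<open>admissible_weak_solution_extinct\<close>). Fubini's theorem and the continuity in \<open>L\<^sup>1\<close> turn this
  into a statement for every \<open>t \<ge> T\<close>.
\<close>

section \<open>Null sets and measurability on the strip\<close>

lemma space_torus: "space torus = {0..<1}"
  by (simp add: torus_def)

lemma finite_measure_torus: "finite_measure torus"
  unfolding torus_def by (rule finite_measure_lebesgue_on) (simp add: fmeasurable_def)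

lemma measure_torus: "measure torus (space torus) = 1"
  unfolding space_torus by (simp add: torus_def measure_restrict_space)

lemma sets_strip_domain: "{0..T::real} \<times> {0..<1::real} \<in> sets lebesgue"
  by (intro sets_completionI_sets) (auto simp: borel_prod[symmetric])

lemma finite_measure_strip: "finite_measure (strip T)"
proof -
  have "{0..T} \<times> {0..<1::real} \<in> lmeasurable"
    by (rule bounded_set_imp_lmeasurable[OF _ sets_strip_domain]) (simp add: bounded_Times)
  then show ?thesis
    unfolding strip_def by (rule finite_measure_lebesgue_on)
qed

lemma AE_strip_iff:
  "(AE z in strip T. P z) \<longleftrightarrow> (AE z in lborel. z \<in> {0..T} \<times> {0..<1} \<longrightarrow> P z)"
  unfolding strip_def
  by (subst AE_restrict_space_iff) (use sets_strip_domain in \<open>auto simp: AE_completion_iff\<close>)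

lemma AE_torus_iff: "(AE x in torus. P x) \<longleftrightarrow> (AE x in lborel. x \<in> {0..<1} \<longrightarrow> P x)"
  unfolding torus_def by (subst AE_restrict_space_iff) (auto simp: AE_completion_iff)

lemma AE_lborel_snd:
  assumes "AE x in lborel. P (x::real)"
  shows "AE z in (lborel :: (real \<times> real) measure). P (snd z)"
proof -
  obtain N where N: "N \<in> null_sets lborel" "{x. \<not> P x} \<subseteq> N"
    using assms by (auto simp: eventually_ae_filter)
  have Nb [measurable]: "N \<in> sets borel"
    using N(1) by auto
  have "AE z in (lborel :: real measure) \<Otimes>\<^sub>M lborel. snd z \<notin> N"
  proof (rule lborel_pair.AE_pair_measure)
    show "{z \<in> space ((lborel :: real measure) \<Otimes>\<^sub>M lborel). snd z \<notin> N}
        \<in> sets ((lborel :: real measure) \<Otimes>\<^sub>M lborel)"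
      by measurable
    show "AE x in (lborel :: real measure). AE y in lborel. snd (x, y) \<notin> N"
      using AE_not_in[OF N(1)] by simp
  qed
  then show ?thesis
    unfolding lborel_prod by eventually_elim (use N(2) in auto)
qed

lemma AE_strip_snd:
  assumes "AE x in torus. P x"
  shows "AE (t, x) in strip T. P x"
  using AE_lborel_snd[OF assms[unfolded AE_torus_iff]] unfolding AE_strip_iff
  by eventually_elim auto

text \<open>
  The library result that Lebesgue measurability survives a change on a null set concerns functions
  on the whole space, so both functions are extended by \<open>0\<close> outside the strip.
\<close>

lemma borel_measurable_strip_AE:
  fixes g h :: "real \<times> real \<Rightarrow> real"
  assumes "g \<in> borel_measurable (strip T)" "AE z in strip T. g z = h z"
  shows "h \<in> borel_measurable (strip T)"
proof -
  let ?D = "{0..T} \<times> {0..<1::real}"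
  have "(\<lambda>z. if z \<in> ?D then g z else 0) \<in> borel_measurable lebesgue"
    using assms(1) unfolding strip_def
    by (subst borel_measurable_if[OF sets_strip_domain])
  moreover have "AE z in lebesgue. (if z \<in> ?D then g z else 0) = (if z \<in> ?D then h z else 0)"
    using assms(2) unfolding AE_strip_iff by (intro AE_completion) auto
  ultimately have "(\<lambda>z. if z \<in> ?D then h z else 0) \<in> borel_measurable lebesgue"
    by (rule borel_measurable_AE)
  then show ?thesis
    unfolding strip_def by (subst (asm) borel_measurable_if[OF sets_strip_domain])
qed

lemma measurable_strip_borel:
  assumes "g \<in> borel_measurable borel"
  shows "g \<in> borel_measurable (strip T)"
  unfolding strip_def using assms
  by (intro measurable_restrict_space1 measurable_completion) simp

text \<open>
  Composition with a projection is not measurable for completed measures in general: the preimage of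
  a null set has to be shown null. Replacing \<open>b\<close> by an almost everywhere equal Borel function
  avoids the question.
\<close>

lemma measurable_strip_snd:
  fixes b :: "real \<Rightarrow> real"
  assumes "b \<in> borel_measurable torus"
  shows "(\<lambda>(t, x). b x) \<in> borel_measurable (strip T)"
proof -
  have "(\<lambda>x. if x \<in> {0..<1} then b x else 0) \<in> borel_measurable lebesgue"
    using assms unfolding torus_def by (subst borel_measurable_if) auto
  then obtain b' where b': "b' \<in> borel_measurable lborel"
      "AE x in lborel. (if x \<in> {0..<1} then b x else 0) = b' x"
    using completion_ex_borel_measurable_real by blast
  have [measurable]: "b' \<in> borel_measurable borel"
    using b'(1) by simp
  have "(\<lambda>z. b' (snd z)) \<in> borel_measurable (strip T)"
    by (intro measurable_strip_borel) (simp add: borel_prod[symmetric])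
  moreover have "AE x in torus. b' x = b x"
    using b'(2) unfolding AE_torus_iff by eventually_elim auto
  then have "AE z in strip T. b' (snd z) = (case z of (t, x) \<Rightarrow> b x)"
    by (rule AE_strip_snd[THEN AE_mp]) auto
  ultimately show ?thesis
    by (rule borel_measurable_strip_AE)
qed

lemma integrable_strip:
  fixes g :: "real \<times> real \<Rightarrow> real"
  assumes "g \<in> borel_measurable (strip T)" "AE z in strip T. \<bar>g z\<bar> \<le> B"
  shows "integrable (strip T) g"
  using finite_measure.integrable_const_bound[OF finite_measure_strip, of g B T] assms by simp


section \<open>Entropy decay at an exponential rate\<close>

lemma avg_deriv_eq_derivative:
  assumes "(\<eta> has_real_derivative d) (at u)"
  shows "avg_deriv \<eta> u = d"
proof -
  have "((\<lambda>v. (\<eta> v - \<eta> u) / (v - u)) \<longlongrightarrow> d) (at u)"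
    using assms by (simp add: has_field_derivative_iff)
  then have "((\<lambda>v. (\<eta> v - \<eta> u) / (v - u)) \<longlongrightarrow> d) (at_left u)"
    "((\<lambda>v. (\<eta> v - \<eta> u) / (v - u)) \<longlongrightarrow> d) (at_right u)"
    by (simp_all add: filterlim_at_split)
  then show ?thesis
    unfolding avg_deriv_def by (simp add: tendsto_Lim)
qed

lemma entropy_flux_exists:
  assumes "continuous_on UNIV (deriv f)" "continuous_on UNIV \<eta>'"
    and "\<And>u. (\<eta> has_real_derivative \<eta>' u) (at u)"
  obtains q where "entropy_flux f \<eta> q"
proof -
  let ?g = "\<lambda>s. deriv f s * \<eta>' s"
  have ig: "?g integrable_on {v..w}" for v w
    by (intro integrable_continuous_real continuous_intros continuous_on_subset[OF assms(1)]
        continuous_on_subset[OF assms(2)]) auto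
  define q where "q w = (if 0 \<le> w then integral {0..w} ?g else - integral {w..0} ?g)" for w
  have split: "integral {a..c} ?g + integral {c..b} ?g = integral {a..b} ?g" if "a \<le> c" "c \<le> b" for a b c
    using that ig by (rule Henstock_Kurzweil_Integration.integral_combine)
  have "q w - q v = integral {v..w} ?g" if "v \<le> w" for v w
    using that split[of v 0 w] split[of v w 0] split[of 0 v w] by (auto simp: q_def)
  then have "entropy_flux f \<eta> q"
    unfolding entropy_flux_def avg_deriv_eq_derivative[OF assms(3)]
    using ig by (simp add: has_integral_integral[symmetric])
  then show thesis ..
qed

text \<open>
  This is the time weight used as test function. With \<open>w t = exp (lam * t) * (S - t)\<close> one has
  \<open>w' = lam * w - exp (lam * t)\<close>: the first term absorbs the decay rate and the second one leaves an
  integral over the whole time interval with an exponential weight.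
\<close>

lemma exponential_weight_lipschitz:
  fixes lam S :: real
  obtains C where "C-lipschitz_on ({0..S} \<times> UNIV) (\<lambda>(t, x::real). exp (lam * t) * (S - t))"
proof -
  let ?w = "\<lambda>t. exp (lam * t) * (S - t)"
  let ?w' = "\<lambda>t. lam * exp (lam * t) * (S - t) - exp (lam * t)"
  have "bounded (?w' ` {0..S})"
    by (intro compact_imp_bounded compact_continuous_image continuous_intros) auto
  then obtain C where "0 < C" "\<forall>y\<in>?w' ` {0..S}. norm y \<le> C"
    unfolding bounded_pos by blast
  then have C: "\<And>t. t \<in> {0..S} \<Longrightarrow> \<bar>?w' t\<bar> \<le> C" "0 < C"
    by (simp_all only: ball_simps real_norm_def)
  have "C-lipschitz_on {0..S} ?w"
  proof (rule bounded_derivative_imp_lipschitz)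
    fix t assume t: "t \<in> {0..S}"
    show "(?w has_derivative (*) (?w' t)) (at t within {0..S})"
      unfolding has_field_derivative_def[symmetric]
      by (rule derivative_eq_intros refl | simp)+
    show "onorm ((*) (?w' t)) \<le> C"
      by (intro onorm_bound less_imp_le[OF C(2)])
        (unfold real_norm_def abs_mult, intro mult_right_mono C(1)[OF t] abs_ge_zero)
  qed (use C(2) in auto)
  then have w: "dist (?w s) (?w t) \<le> C * dist s t" if "s \<in> {0..S}" "t \<in> {0..S}" for s t
    by (rule lipschitz_onD[OF _ that])
  have "C-lipschitz_on ({0..S} \<times> UNIV) (\<lambda>(t, x::real). ?w t)"
  proof (rule lipschitz_onI)
    fix y z :: "real \<times> real" assume "y \<in> {0..S} \<times> UNIV" "z \<in> {0..S} \<times> UNIV"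
    then have "dist (?w (fst y)) (?w (fst z)) \<le> C * dist (fst y) (fst z)"
      by (intro w) auto
    also have "\<dots> \<le> C * dist y z"
      using C(2) by (intro mult_left_mono dist_fst_le) auto
    finally show "dist (case y of (t, x) \<Rightarrow> ?w t) (case z of (t, x) \<Rightarrow> ?w t) \<le> C * dist y z"
      by (simp add: case_prod_beta')
  qed (use C(2) in simp)
  then show thesis ..
qed

text \<open>
  Formally \<open>\<integral> \<eta> u dx\<close> decays at the rate \<open>lam\<close> because \<open>\<eta>' h\<close> dominates \<open>lam * \<eta>\<close>; multiplying by
  the integrating factor \<open>exp (lam * t)\<close> and integrating over \<open>[0,S]\<close> gives the estimate. The
  measurability and boundedness of \<open>h\<close> are essential to the argument, since the
  Bochner integral of a non-integrable function is \<open>0\<close> and would carry no information.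
\<close>

lemma entropy_decay:
  fixes f u0 \<eta> \<eta>' :: "real \<Rightarrow> real" and u h :: "real \<Rightarrow> real \<Rightarrow> real" and lam S :: real
  assumes ent: "entropy_inequality f u0 S u h"
    and u: "bounded_measurable_strip S u"
    and hm: "(\<lambda>(t, x). h t x) \<in> borel_measurable (strip S)"
    and hb: "AE (t, x) in strip S. \<bar>h t x\<bar> \<le> H"
    and f: "continuous_on UNIV (deriv f)"
    and d: "\<And>s. (\<eta> has_real_derivative \<eta>' s) (at s)"
    and mono: "mono \<eta>'" and cont: "continuous_on UNIV \<eta>'"
    and S: "0 < S"
    and rate: "AE (t, x) in strip S. lam * \<eta> (u t x) \<le> \<eta>' (u t x) * h t x"
  shows "integrable (strip S) (\<lambda>(t, x). exp (lam * t) * \<eta> (u t x))"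
    and "(LINT (t, x)|strip S. exp (lam * t) * \<eta> (u t x)) \<le> S * (LINT x|torus. \<eta> (u0 x))"
proof -
  obtain U where U: "\<And>t x. t \<in> {0..S} \<Longrightarrow> \<bar>u t x\<bar> \<le> U"
    using u unfolding bounded_measurable_strip_def by blast
  have [measurable]: "(\<lambda>z. u (fst z) (snd z)) \<in> borel_measurable (strip S)"
    "(\<lambda>z. h (fst z) (snd z)) \<in> borel_measurable (strip S)"
    using u hm by (simp_all add: bounded_measurable_strip_def case_prod_beta')
  have [measurable]: "fst \<in> borel_measurable (strip S)"
    by (intro measurable_strip_borel) (simp add: borel_prod[symmetric])
  have c\<eta>: "continuous_on UNIV \<eta>"
    using d by (intro DERIV_continuous_on) (auto intro: DERIV_subset)
  have [measurable]: "\<eta> \<in> borel_measurable borel" "\<eta>' \<in> borel_measurable borel"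
    using c\<eta> cont by (auto intro: borel_measurable_continuous_onI)
  have "\<exists>B. \<forall>s\<in>{-U..U}. \<bar>g s\<bar> \<le> B" if "continuous_on UNIV g" for g :: "real \<Rightarrow> real"
    using compact_imp_bounded[OF compact_continuous_image[OF continuous_on_subset[OF that] compact_Icc[of "-U" U]]]
    by (auto simp: bounded_iff)
  then obtain B B' where B: "\<And>s. \<bar>s\<bar> \<le> U \<Longrightarrow> \<bar>\<eta> s\<bar> \<le> B" and B': "\<And>s. \<bar>s\<bar> \<le> U \<Longrightarrow> \<bar>\<eta>' s\<bar> \<le> B'"
    using c\<eta> cont by (metis abs_le_iff atLeastAtMost_iff minus_le_iff)
  define E where "E = exp (\<bar>lam\<bar> * S)"
  have E: "exp (lam * t) \<le> E" if "t \<in> {0..S}" for t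
  proof -
    have "lam * t \<le> \<bar>lam\<bar> * t" "\<bar>lam\<bar> * t \<le> \<bar>lam\<bar> * S"
      using that by (auto intro!: mult_right_mono mult_left_mono)
    then show ?thesis
      unfolding E_def by simp
  qed
  have in_strip: "AE z in strip S. fst z \<in> {0..S}"
    unfolding AE_strip_iff by auto
  let ?F = "\<lambda>z. exp (lam * fst z) * \<eta> (u (fst z) (snd z))"
  have iF: "integrable (strip S) ?F"
  proof (rule integrable_strip)
    show "AE z in strip S. \<bar>?F z\<bar> \<le> E * B"
      using in_strip
      by eventually_elim (simp only: abs_mult abs_exp_cancel, intro mult_mono' E B U, auto)
  qed measurable
  then show "integrable (strip S) (\<lambda>(t, x). exp (lam * t) * \<eta> (u t x))"
    by (simp add: case_prod_beta')
  let ?K = "\<lambda>z. exp (lam * fst z) * (S - fst z) * (\<eta>' (u (fst z) (snd z)) * h (fst z) (snd z))"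
  have iK: "integrable (strip S) ?K"
  proof (rule integrable_strip)
    show "AE z in strip S. \<bar>?K z\<bar> \<le> E * S * (B' * H)"
      using in_strip hb
      by eventually_elim (simp only: abs_mult abs_exp_cancel case_prod_beta', intro mult_mono' E B' U, auto)
  qed measurable
  \<comment> \<open>\<open>?L\<close> and \<open>?F\<close> are the two parts of the term with the time derivative, \<open>?K\<close> is the
    source term; \<open>?L \<le> ?K\<close> will leave only \<open>?F\<close>.\<close>
  let ?L = "\<lambda>z. exp (lam * fst z) * (S - fst z) * (lam * \<eta> (u (fst z) (snd z)))"
  have iL: "integrable (strip S) ?L"
  proof (rule integrable_strip)
    show "AE z in strip S. \<bar>?L z\<bar> \<le> E * S * (\<bar>lam\<bar> * B)"
      using in_strip
      by eventually_elim (simp only: abs_mult abs_exp_cancel, intro mult_mono' E B U, auto)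
  qed measurable
  define \<psi> where "\<psi> t x = exp (lam * t) * (S - t)" for t x :: real
  have pt: "pd_t \<psi> t x = lam * exp (lam * t) * (S - t) - exp (lam * t)" for t x
    unfolding pd_t_def \<psi>_def by (rule DERIV_imp_deriv) (auto intro!: derivative_eq_intros)
  have px: "pd_x \<psi> t x = 0" for t x
    unfolding pd_x_def \<psi>_def by simp
  obtain q where q: "entropy_flux f \<eta> q"
    using entropy_flux_exists[OF f cont d] .
  obtain C where C: "C-lipschitz_on ({0..S} \<times> UNIV) (\<lambda>(t, x). \<psi> t x)"
    using exponential_weight_lipschitz[of S lam] unfolding \<psi>_def by blast
  have per: "periodic1 (\<psi> t)" for t
    by (simp add: \<psi>_def periodic_fun_simple'_def)
  have nonneg: "0 \<le> \<psi> t x" if "t \<in> {0..S}" for t x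
    using that by (simp add: \<psi>_def)
  have final: "\<psi> S x = 0" for x
    by (simp add: \<psi>_def)
  have conv: "convex_on UNIV \<eta>"
    by (rule convex_on_realI[OF _ d]) (use mono in \<open>auto simp: mono_def\<close>)
  have "0 \<le> (LINT (t, x)|strip S.
            pd_t \<psi> t x * \<eta> (u t x) + pd_x \<psi> t x * q (u t x) - \<psi> t x * avg_deriv \<eta> (u t x) * h t x)
          + (LINT x|torus. \<psi> 0 x * \<eta> (u0 x))"
    by (rule ent[unfolded entropy_inequality_def, rule_format, OF conv q _ C])
      (use per nonneg final in auto)
  also have "(LINT (t, x)|strip S.
            pd_t \<psi> t x * \<eta> (u t x) + pd_x \<psi> t x * q (u t x) - \<psi> t x * avg_deriv \<eta> (u t x) * h t x)
      = (LINT z|strip S. ?L z - ?F z - ?K z)"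
    unfolding pt px avg_deriv_eq_derivative[OF d] case_prod_beta'
    by (intro Bochner_Integration.integral_cong refl) (simp add: \<psi>_def algebra_simps)
  also have "(LINT x|torus. \<psi> 0 x * \<eta> (u0 x)) = S * (LINT x|torus. \<eta> (u0 x))"
    by (simp add: \<psi>_def)
  also have "(LINT z|strip S. ?L z - ?F z - ?K z) \<le> (LINT z|strip S. - ?F z)"
  proof (rule integral_mono_AE)
    show "AE z in strip S. ?L z - ?F z - ?K z \<le> - ?F z"
      using in_strip rate
    proof eventually_elim
      case (elim z)
      then have "?L z \<le> ?K z"
        by (intro mult_left_mono) (auto simp: case_prod_beta')
      then show ?case by simp
    qed
  qed (use iF iK iL in auto)
  finally show "(LINT (t, x)|strip S. exp (lam * t) * \<eta> (u t x)) \<le> S * (LINT x|torus. \<eta> (u0 x))"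
    by (simp add: case_prod_beta')
qed



section \<open>An entropy adapted to the damping\<close>

definition damping_entropy :: "real \<Rightarrow> real \<Rightarrow> real \<Rightarrow> real" where
  "damping_entropy \<alpha> m u = u\<^sup>2 * exp (m * \<bar>u\<bar> powr \<alpha>)"

text \<open>
  The form \<open>u * _\<close> avoids \<open>\<bar>u\<bar> powr (\<alpha> - 1)\<close>, which is singular at \<open>0\<close>.
\<close>

definition damping_entropy_deriv :: "real \<Rightarrow> real \<Rightarrow> real \<Rightarrow> real" where
  "damping_entropy_deriv \<alpha> m u = u * ((2 + m * \<alpha> * \<bar>u\<bar> powr \<alpha>) * exp (m * \<bar>u\<bar> powr \<alpha>))"

lemma continuous_on_damping_entropy_deriv:
  assumes "0 < \<alpha>"
  shows "continuous_on UNIV (damping_entropy_deriv \<alpha> m)"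
  unfolding damping_entropy_deriv_def using assms
  by (intro continuous_intros continuous_on_powr') auto

lemma mono_damping_entropy_deriv:
  assumes "0 < \<alpha>" "0 \<le> m"
  shows "mono (damping_entropy_deriv \<alpha> m)"
proof -
  let ?d = "damping_entropy_deriv \<alpha> m"
  have pos: "?d x \<le> ?d y" if "0 \<le> x" "x \<le> y" for x y
  proof -
    have "\<bar>x\<bar> powr \<alpha> \<le> \<bar>y\<bar> powr \<alpha>"
      using that assms by (intro powr_mono2) auto
    then show ?thesis
      unfolding damping_entropy_deriv_def using that assms
      by (intro mult_mono add_left_mono mult_left_mono) (auto intro!: mult_nonneg_nonneg add_nonneg_nonneg mult_left_mono)
  qed
  have odd: "?d (- x) = - ?d x" for x
    by (simp add: damping_entropy_deriv_def)
  have zero: "?d 0 = 0"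
    by (simp add: damping_entropy_deriv_def)
  show ?thesis
  proof (rule monoI)
    fix x y :: real assume xy: "x \<le> y"
    consider "0 \<le> x" | "y \<le> 0" | "x \<le> 0" "0 \<le> y" by linarith
    then show "?d x \<le> ?d y"
    proof cases
      case 1 then show ?thesis using pos xy by blast
    next
      case 2 then show ?thesis using pos[of "- y" "- x"] xy by (simp add: odd)
    next
      case 3 then show ?thesis using pos[of 0 "- x"] pos[of 0 y] by (simp add: odd zero)
    qed
  qed
qed

text \<open>
  The chain rule gives the derivative for positive \<open>u\<close> and evenness for negative \<open>u\<close>. At \<open>0\<close> the
  function \<open>\<bar>u\<bar> powr \<alpha>\<close> is not differentiable, but the difference quotient of the entropy is
  \<open>v * exp (m * \<bar>v\<bar> powr \<alpha>)\<close> and tends to \<open>0\<close>.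
\<close>

lemma damping_entropy_has_derivative:
  assumes "0 < \<alpha>"
  shows "(damping_entropy \<alpha> m has_real_derivative damping_entropy_deriv \<alpha> m u) (at u)"
proof -
  let ?G = "damping_entropy \<alpha> m" and ?d = "damping_entropy_deriv \<alpha> m"
  have pos: "(?G has_real_derivative ?d x) (at x)" if "0 < x" for x
  proof (rule DERIV_cong[OF has_field_derivative_transform_within_open])
    show "((\<lambda>v. v\<^sup>2 * exp (m * v powr \<alpha>)) has_real_derivative
        2 * x * exp (m * x powr \<alpha>) + (exp (m * x powr \<alpha>) * (m * (\<alpha> * x powr (\<alpha> - 1)))) * x\<^sup>2) (at x)"
      using that by (auto intro!: derivative_eq_intros)
    show "v\<^sup>2 * exp (m * v powr \<alpha>) = ?G v" if "v \<in> {0<..}" for v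
      using that by (simp add: damping_entropy_def)
    have "x powr (\<alpha> - 1) * x\<^sup>2 = x * x powr \<alpha>"
      using that by (simp add: powr_diff power2_eq_square)
    then show "2 * x * exp (m * x powr \<alpha>) + (exp (m * x powr \<alpha>) * (m * (\<alpha> * x powr (\<alpha> - 1)))) * x\<^sup>2 = ?d x"
      using that by (simp add: damping_entropy_deriv_def algebra_simps)
  qed (use that in auto)
  consider "0 < u" | "u < 0" | "u = 0" by linarith
  then show ?thesis
  proof cases
    case 1 then show ?thesis by (rule pos)
  next
    case 2
    have "?G = (\<lambda>x. ?G (- x))"
      by (simp add: damping_entropy_def fun_eq_iff)
    moreover have "?d u = - ?d (- u)"
      by (simp add: damping_entropy_deriv_def)
    ultimately show ?thesis
      using pos[of "- u"] 2 by (metis DERIV_mirror neg_0_less_iff_less)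
  next
    case 3
    have "continuous_on UNIV (\<lambda>v. v * exp (m * \<bar>v\<bar> powr \<alpha>))"
      using assms by (intro continuous_intros continuous_on_powr') auto
    then have "((\<lambda>v. v * exp (m * \<bar>v\<bar> powr \<alpha>)) \<longlongrightarrow> 0) (at 0)"
      by (metis (no_types, lifting) UNIV_I continuous_on_def mult_zero_left at_within_open open_UNIV)
    moreover have "\<forall>\<^sub>F v in at 0. v * exp (m * \<bar>v\<bar> powr \<alpha>) = (?G v - ?G 0) / (v - 0)"
      by (auto simp: eventually_at_filter damping_entropy_def power2_eq_square)
    ultimately have "((\<lambda>v. (?G v - ?G 0) / (v - 0)) \<longlongrightarrow> 0) (at 0)"
      by (rule Lim_transform_eventually)
    then show ?thesis
      using 3 by (simp add: has_field_derivative_iff damping_entropy_deriv_def)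
  qed
qed

text \<open>
  The derivative of the exponential contributes \<open>m * \<alpha> * \<bar>v\<bar> powr \<alpha>\<close>, whose power of \<open>\<bar>v\<bar>\<close> cancels
  the denominator of \<open>h\<close>; the derivative of \<open>v\<^sup>2\<close> contributes a nonnegative term which is dropped.
  At \<open>v = 0\<close> both sides vanish.
\<close>

lemma damping_entropy_dissipation:
  assumes "0 < \<alpha>" "0 \<le> m" "0 < \<delta>" "\<delta> \<le> b" "v \<noteq> 0 \<Longrightarrow> h = b * (v / \<bar>v\<bar> powr \<alpha>)"
  shows "m * \<alpha> * \<delta> * damping_entropy \<alpha> m v \<le> damping_entropy_deriv \<alpha> m v * h"
proof (cases "v = 0")
  case False
  define p where "p = \<bar>v\<bar> powr \<alpha>"
  have p: "0 < p"
    using False by (simp add: p_def)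
  have "m * \<alpha> * \<delta> \<le> b * (2 / p + m * \<alpha>)"
    using mult_mono[of \<delta> b "m * \<alpha>" "2 / p + m * \<alpha>"] assms p by (simp add: mult.commute)
  then have "(m * \<alpha> * \<delta>) * (v\<^sup>2 * exp (m * p)) \<le> (b * (2 / p + m * \<alpha>)) * (v\<^sup>2 * exp (m * p))"
    by (rule mult_right_mono) simp
  also have "\<dots> = damping_entropy_deriv \<alpha> m v * h"
    using p False unfolding damping_entropy_deriv_def assms(5)[OF False] p_def[symmetric]
    by (simp add: field_simps power2_eq_square)
  finally show ?thesis
    by (simp add: damping_entropy_def p_def)
qed (simp add: damping_entropy_def damping_entropy_deriv_def)


section \<open>Extinction\<close>

lemma Linf_norm_bound:
  assumes "Linf_torus g"
  shows "AE x in torus. \<bar>g x\<bar> \<le> Linf_norm g"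
proof -
  obtain C where C: "AE x in torus. \<bar>g x\<bar> \<le> C" and [measurable]: "g \<in> borel_measurable torus"
    using assms by (auto simp: Linf_torus_def)
  let ?e = "esssup torus (\<lambda>x. ereal \<bar>g x\<bar>)"
  have "?e \<le> ereal C"
    using C by (intro esssup_I) auto
  then have "\<bar>g x\<bar> \<le> real_of_ereal ?e" if "ereal \<bar>g x\<bar> \<le> ?e" for x
    using that by (cases ?e) auto
  then show ?thesis
    unfolding Linf_norm_def using esssup_AE[of "\<lambda>x. ereal \<bar>g x\<bar>" torus] by (auto elim: eventually_mono)
qed

text \<open>
  This unifies the two cases of the definition of admissible solutions: for \<open>\<alpha> < 1\<close> the source is
  explicit, and for \<open>\<alpha> = 1\<close> membership in \<open>a x * Sign u\<close> determines it wherever \<open>u \<noteq> 0\<close>.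
\<close>

lemma admissible_weak_solution_source:
  assumes sol: "admissible_weak_solution f \<alpha> a u0 S u"
    and "0 < \<alpha>" "\<alpha> \<le> 1" and A: "condition_A a"
  obtains h H where
    "(\<lambda>(t, x). h t x) \<in> borel_measurable (strip S)"
    "AE (t, x) in strip S. \<bar>h t x\<bar> \<le> H"
    "AE (t, x) in strip S. u t x \<noteq> 0 \<longrightarrow> h t x = a x * (u t x / \<bar>u t x\<bar> powr \<alpha>)"
    "entropy_inequality f u0 S u h"
proof (cases "\<alpha> < 1")
  case True
  have u: "bounded_measurable_strip S u"
    and ent: "entropy_inequality f u0 S u (\<lambda>t x. a x * (u t x / \<bar>u t x\<bar> powr \<alpha>))"
    using sol True by (auto simp: admissible_weak_solution_def)
  obtain U where U: "\<And>t x. t \<in> {0..S} \<Longrightarrow> \<bar>u t x\<bar> \<le> U"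
    using u unfolding bounded_measurable_strip_def by blast
  have [measurable]: "(\<lambda>z. u (fst z) (snd z)) \<in> borel_measurable (strip S)"
    using u by (simp add: bounded_measurable_strip_def case_prod_beta')
  have am: "a \<in> borel_measurable torus"
    using A by (simp add: condition_A_def Linf_torus_def)
  have [measurable]: "(\<lambda>z. a (snd z)) \<in> borel_measurable (strip S)"
    using measurable_strip_snd[OF am] by (simp add: case_prod_beta')
  obtain B where B: "AE x in torus. \<bar>a x\<bar> \<le> B"
    using A by (auto simp: condition_A_def Linf_torus_def)
  show thesis
  proof (rule that[OF _ _ _ ent])
    show "(\<lambda>(t, x). a x * (u t x / \<bar>u t x\<bar> powr \<alpha>)) \<in> borel_measurable (strip S)"
      unfolding case_prod_beta' by measurable
    have "AE z in strip S. fst z \<in> {0..S}"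
      unfolding AE_strip_iff by auto
    with AE_strip_snd[OF B]
    show "AE (t, x) in strip S. \<bar>a x * (u t x / \<bar>u t x\<bar> powr \<alpha>)\<bar> \<le> B * U powr (1 - \<alpha>)"
    proof eventually_elim
      case (elim z)
      let ?v = "u (fst z) (snd z)"
      have "\<bar>?v / \<bar>?v\<bar> powr \<alpha>\<bar> = \<bar>?v\<bar> powr (1 - \<alpha>)"
        by (simp add: powr_diff abs_divide)
      also have "\<dots> \<le> U powr (1 - \<alpha>)"
        using True elim by (intro powr_mono2 U) auto
      finally have "\<bar>a (snd z)\<bar> * \<bar>?v / \<bar>?v\<bar> powr \<alpha>\<bar> \<le> B * U powr (1 - \<alpha>)"
        using elim by (intro mult_mono') (auto simp: case_prod_beta')
      then show ?case
        by (simp add: case_prod_beta' abs_mult)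
    qed
  qed auto
next
  case False
  then have \<alpha>: "\<alpha> = 1"
    using assms by simp
  obtain h where h: "Linf_strip S h" "entropy_inequality f u0 S u h"
    and sgn: "AE (t, x) in strip S. h t x \<in> (\<lambda>s. a x * s) ` Sign (u t x)"
    using sol False by (auto simp: admissible_weak_solution_def)
  obtain H where H: "AE (t, x) in strip S. \<bar>h t x\<bar> \<le> H"
    using h(1) by (auto simp: Linf_strip_def)
  show thesis
  proof (rule that[OF _ H _ h(2)])
    show "(\<lambda>(t, x). h t x) \<in> borel_measurable (strip S)"
      using h(1) by (simp add: Linf_strip_def)
    show "AE (t, x) in strip S. u t x \<noteq> 0 \<longrightarrow> h t x = a x * (u t x / \<bar>u t x\<bar> powr \<alpha>)"
      using sgn by eventually_elim (auto simp: Sign_def \<alpha> split: if_splits)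
  qed
qed

text \<open>
  The function \<open>g\<close> of the proof is what is left of the entropy after \<open>exp y \<ge> y\<close>: it does not
  depend on \<open>m\<close>, and \<open>m\<close> times its integral stays bounded as \<open>m\<close> grows.
\<close>

lemma admissible_weak_solution_extinct:
  assumes sol: "admissible_weak_solution f \<alpha> a u0 S u"
    and f: "continuous_on UNIV (deriv f)"
    and \<alpha>: "0 < \<alpha>" "\<alpha> \<le> 1" and A: "condition_A a"
    and \<delta>: "0 < \<delta>" "\<And>x. \<delta> \<le> a x"
    and u0: "Linf_torus u0"
    and S: "0 < S"
  shows "AE (t, x) in strip S. 1 / (\<alpha> * \<delta>) * Linf_norm u0 powr \<alpha> \<le> t \<longrightarrow> u t x = 0"
proof -
  define M where "M = Linf_norm u0"
  define T where "T = 1 / (\<alpha> * \<delta>) * M powr \<alpha>"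
  have T: "\<alpha> * \<delta> * T = M powr \<alpha>"
    using \<alpha> \<delta> by (simp add: T_def)
  have u: "bounded_measurable_strip S u"
    using sol by (simp add: admissible_weak_solution_def)
  obtain U where U: "\<And>t x. t \<in> {0..S} \<Longrightarrow> \<bar>u t x\<bar> \<le> U"
    using u unfolding bounded_measurable_strip_def by blast
  have [measurable]: "(\<lambda>z. u (fst z) (snd z)) \<in> borel_measurable (strip S)"
    using u by (simp add: bounded_measurable_strip_def case_prod_beta')
  have [measurable]: "fst \<in> borel_measurable (strip S)"
    by (intro measurable_strip_borel) (simp add: borel_prod[symmetric])
  have [measurable]: "u0 \<in> borel_measurable torus"
    using u0 by (simp add: Linf_torus_def)
  obtain h H where h: "(\<lambda>(t, x). h t x) \<in> borel_measurable (strip S)"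
    "AE (t, x) in strip S. \<bar>h t x\<bar> \<le> H"
    "AE (t, x) in strip S. u t x \<noteq> 0 \<longrightarrow> h t x = a x * (u t x / \<bar>u t x\<bar> powr \<alpha>)"
    "entropy_inequality f u0 S u h"
    using admissible_weak_solution_source[OF sol \<alpha> A] .
  define g where "g z = (if T \<le> fst z then (u (fst z) (snd z))\<^sup>2 * \<bar>u (fst z) (snd z)\<bar> powr \<alpha> else 0)" for z
  have [measurable]: "g \<in> borel_measurable (strip S)"
    unfolding g_def by measurable
  have g0: "0 \<le> g z" for z
    by (simp add: g_def)
  have ig: "integrable (strip S) g"
  proof (rule integrable_strip)
    have "AE z in strip S. fst z \<in> {0..S}"
      unfolding AE_strip_iff by auto
    then show "AE z in strip S. \<bar>g z\<bar> \<le> U\<^sup>2 * U powr \<alpha>"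
    proof eventually_elim
      case (elim z)
      let ?v = "u (fst z) (snd z)"
      have v: "\<bar>?v\<bar> \<le> U"
        using U elim by blast
      have "?v\<^sup>2 * \<bar>?v\<bar> powr \<alpha> \<le> U\<^sup>2 * U powr \<alpha>"
        using v \<alpha> by (intro mult_mono' powr_mono2 power2_le_iff_abs_le[THEN iffD2]) auto
      then show ?case
        by (simp add: g_def)
    qed
  qed measurable
  have bound: "m * (LINT z|strip S. g z) \<le> S * M\<^sup>2" if m: "0 < m" for m
  proof -
    let ?G = "damping_entropy \<alpha> m"
    let ?E = "exp (m * M powr \<alpha>)"
    have rate: "AE (t, x) in strip S.
        (m * \<alpha> * \<delta>) * ?G (u t x) \<le> damping_entropy_deriv \<alpha> m (u t x) * h t x"
      using h(3)
    proof eventually_elim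
      case (elim z)
      then show ?case
        using damping_entropy_dissipation[OF \<alpha>(1) less_imp_le[OF m] \<delta>(1) \<delta>(2)[of "snd z"]]
        by (auto simp: case_prod_beta')
    qed
    note decay = entropy_decay[OF h(4) u h(1,2) f damping_entropy_has_derivative[OF \<alpha>(1)]
        mono_damping_entropy_deriv[OF \<alpha>(1) less_imp_le[OF m]]
        continuous_on_damping_entropy_deriv[OF \<alpha>(1)] S rate]
    have "?E * (m * (LINT z|strip S. g z)) = (LINT z|strip S. ?E * (m * g z))"
      by simp
    also have "\<dots> \<le> (LINT (t, x)|strip S. exp (m * \<alpha> * \<delta> * t) * ?G (u t x))"
    proof (rule integral_mono)
      show "integrable (strip S) (\<lambda>z. ?E * (m * g z))"
        using ig by simp
      show "integrable (strip S) (\<lambda>(t, x). exp (m * \<alpha> * \<delta> * t) * ?G (u t x))"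
        by (rule decay(1))
      fix z :: "real \<times> real"
      let ?v = "u (fst z) (snd z)"
      have "?E * (m * g z) \<le> exp (m * \<alpha> * \<delta> * fst z) * ?G ?v"
      proof (cases "T \<le> fst z")
        case True
        have "m * M powr \<alpha> = m * (\<alpha> * \<delta>) * T"
          using T by (simp add: mult.assoc)
        also have "\<dots> \<le> m * (\<alpha> * \<delta>) * fst z"
          using True \<alpha> \<delta> m by (intro mult_left_mono) auto
        finally have "?E \<le> exp (m * \<alpha> * \<delta> * fst z)"
          by (simp add: mult.assoc)
        moreover have "m * \<bar>?v\<bar> powr \<alpha> \<le> exp (m * \<bar>?v\<bar> powr \<alpha>)"
          using exp_ge_add_one_self[of "m * \<bar>?v\<bar> powr \<alpha>"] by linarith
        then have "?v\<^sup>2 * (m * \<bar>?v\<bar> powr \<alpha>) \<le> ?G ?v"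
          unfolding damping_entropy_def by (rule mult_left_mono) simp
        ultimately show ?thesis
          using True m by (intro mult_mono) (auto simp: g_def mult_ac)
      qed (simp add: g_def damping_entropy_def)
      then show "?E * (m * g z) \<le> (case z of (t, x) \<Rightarrow> exp (m * \<alpha> * \<delta> * t) * ?G (u t x))"
        by (simp add: case_prod_beta')
    qed
    also have "\<dots> \<le> S * (LINT x|torus. ?G (u0 x))"
      by (rule decay(2))
    also have "(LINT x|torus. ?G (u0 x)) \<le> M\<^sup>2 * ?E"
    proof -
      have le: "AE x in torus. ?G (u0 x) \<le> M\<^sup>2 * ?E"
        using Linf_norm_bound[OF u0]
      proof eventually_elim
        case (elim x)
        then have "\<bar>u0 x\<bar> powr \<alpha> \<le> M powr \<alpha>"
          using \<alpha> by (intro powr_mono2) (auto simp: M_def)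
        then show ?case
          unfolding damping_entropy_def using elim m
          by (intro mult_mono' power2_le_iff_abs_le[THEN iffD2]) (auto simp: M_def)
      qed
      interpret finite_measure torus
        by (rule finite_measure_torus)
      have "integrable torus (\<lambda>x. ?G (u0 x))"
        by (rule integrable_const_bound[where B = "M\<^sup>2 * ?E"])
          (use le in \<open>auto simp: damping_entropy_def\<close>)
      then have "(LINT x|torus. ?G (u0 x)) \<le> (LINT x|torus. M\<^sup>2 * ?E)"
        using le by (intro integral_mono_AE) auto
      then show ?thesis
        by (simp add: measure_torus)
    qed
    finally have "?E * (m * (LINT z|strip S. g z)) \<le> ?E * (S * M\<^sup>2)"
      using S by (simp add: mult_ac)
    then show ?thesis
      by simp
  qed
  have "(LINT z|strip S. g z) \<le> 0"
  proof (rule ccontr)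
    let ?I = "LINT z|strip S. g z"
    assume "\<not> ?I \<le> 0"
    then have I: "0 < ?I" by simp
    \<comment> \<open>This \<open>m\<close> makes the left-hand side of \<open>bound\<close> equal to \<open>S * M\<^sup>2 + 1\<close>.\<close>
    have "(S * M\<^sup>2 + 1) / ?I * ?I \<le> S * M\<^sup>2"
      using I S by (intro bound divide_pos_pos add_nonneg_pos) auto
    then show False
      using I by simp
  qed
  moreover have "0 \<le> (LINT z|strip S. g z)"
    using g0 by (intro Bochner_Integration.integral_nonneg) auto
  ultimately have "(LINT z|strip S. g z) = 0"
    by (rule antisym)
  then have "AE z in strip S. g z = 0"
    using integral_nonneg_eq_0_iff_AE[OF ig] g0 by simp
  then show ?thesis
    unfolding M_def[symmetric] T_def[symmetric]
    by eventually_elim (auto simp: g_def case_prod_beta')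
qed

lemma AE_strip_slices:
  assumes "AE (t, x) in strip S. P t x"
  shows "AE t in lborel. t \<in> {0..S} \<longrightarrow> (AE x in torus. P t x)"
proof -
  have "AE z in lborel \<Otimes>\<^sub>M lborel. z \<in> {0..S} \<times> {0..<1::real} \<longrightarrow> (case z of (t, x) \<Rightarrow> P t x)"
    using assms unfolding AE_strip_iff lborel_prod .
  from lborel_pair.AE_pair[OF this] show ?thesis
    by eventually_elim (auto simp: AE_torus_iff)
qed

text \<open>
  For almost every \<open>s > t\<close> the \<open>L\<^sup>1\<close> distance of \<open>u s\<close> to \<open>u t\<close> is the \<open>L\<^sup>1\<close> norm of \<open>u t\<close>, while
  continuity makes it tend to \<open>0\<close>. An interval to the right of \<open>t\<close> has positive measure, so it
  contains such an \<open>s\<close>; using only later times covers the first instant of extinction.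
\<close>

lemma C0_L1_zero_from_right:
  assumes u: "C0_L1 u" and t: "0 \<le> t" "t < S"
    and zero: "AE s in lborel. s \<in> {t..S} \<longrightarrow> (AE x in torus. u s x = 0)"
  shows "AE x in torus. u t x = 0"
proof -
  let ?g = "\<lambda>s. LINT x|torus. \<bar>u s x - u t x\<bar>"
  let ?c = "LINT x|torus. \<bar>u t x\<bar>"
  have int: "integrable torus (u s)" if "0 \<le> s" for s
    using u that by (simp add: C0_L1_def)
  have lim: "(?g \<longlongrightarrow> 0) (at t within {0..})"
    using u t by (simp add: C0_L1_def)
  have "?c \<le> 0"
  proof (rule ccontr)
    assume "\<not> ?c \<le> 0"
    then have "\<forall>\<^sub>F s in at t within {0..}. ?g s < ?c"
      using order_tendstoD(2)[OF lim, of ?c] by simp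
    then obtain d where d: "0 < d" "\<And>s. 0 \<le> s \<Longrightarrow> s \<noteq> t \<Longrightarrow> dist s t < d \<Longrightarrow> ?g s < ?c"
      by (auto simp: eventually_at)
    define r where "r = min (t + d) S"
    have r: "t < r" "r \<le> S" "r \<le> t + d"
      using d(1) t by (auto simp: r_def)
    \<comment> \<open>Every time in this interval is exceptional, so it would have to be a null set.\<close>
    have "AE s in lborel. s \<notin> {t<..<r}"
      using zero
    proof eventually_elim
      case (elim s)
      show ?case
      proof
        assume s: "s \<in> {t<..<r}"
        then have "AE x in torus. u s x = 0"
          using elim r by auto
        then have "AE x in torus. \<bar>u s x - u t x\<bar> = \<bar>u t x\<bar>"
          by eventually_elim simp
        then have "?g s = ?c"
          using int s t by (intro integral_cong_AE) auto
        moreover have "?g s < ?c"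
          using s r t by (intro d(2)) (auto simp: dist_real_def)
        ultimately show False by simp
      qed
    qed
    then have "emeasure lborel {t<..<r} = 0"
      by (subst (asm) AE_iff_measurable[OF _ refl])
        (auto simp: greaterThanLessThan_def greaterThan_def lessThan_def Collect_conj_eq)
    then show False
      using r by simp
  qed
  moreover have "0 \<le> ?c"
    by (intro Bochner_Integration.integral_nonneg) auto
  ultimately have "AE x in torus. \<bar>u t x\<bar> = 0"
    using integral_nonneg_eq_0_iff_AE[of torus "\<lambda>x. \<bar>u t x\<bar>"] int[OF t(1)] by simp
  then show ?thesis
    by simp
qed

theorem proposition1p7:
  fixes f a u0 :: "real \<Rightarrow> real" and \<alpha> \<delta> :: real
  assumes "smooth f"
    and "0 < \<alpha>" and "\<alpha> \<le> 1"
    and "condition_A a"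
    and "\<delta> > 0" and "\<And>x. a x \<ge> \<delta>"
    and "Linf_torus u0"
  shows "(\<exists>T>0. \<forall>u. is_solution f \<alpha> a u0 u \<longrightarrow> (\<forall>t\<ge>T. AE x in torus. u t x = 0)) \<and>
         (\<forall>u. is_solution f \<alpha> a u0 u \<longrightarrow>
            (\<forall>t \<ge> 1 / (\<alpha> * \<delta>) * Linf_norm u0 powr \<alpha>. AE x in torus. u t x = 0))"
proof -
  let ?T = "1 / (\<alpha> * \<delta>) * Linf_norm u0 powr \<alpha>"
  have T: "0 \<le> ?T"
    using assms(2,5) by simp
  have f: "continuous_on UNIV (deriv f)"
    using assms(1)[unfolded smooth_def, rule_format, of 1]
    by (simp add: continuous_on_eq_continuous_at differentiable_imp_continuous_within)
  have ext: "AE x in torus. u t x = 0" if sol: "is_solution f \<alpha> a u0 u" and t: "?T \<le> t" for u t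
  proof -
    obtain v where v: "global_admissible_weak_solution f \<alpha> a u0 v"
      "AE s in lebesgue_on {0..}. AE x in torus. u s x = v s x"
      using sol unfolding is_solution_def by blast
    have "0 \<le> t"
      using T t by simp
    then have "admissible_weak_solution f \<alpha> a u0 (t + 1) v"
      using v(1) by (simp add: global_admissible_weak_solution_def)
    from admissible_weak_solution_extinct[OF this f assms(2-7)] \<open>0 \<le> t\<close>
    have "AE (s, x) in strip (t + 1). ?T \<le> s \<longrightarrow> v s x = 0"
      by simp
    from AE_strip_slices[OF this]
    have "AE s in lborel. s \<in> {0..t + 1} \<longrightarrow> (AE x in torus. ?T \<le> s \<longrightarrow> v s x = 0)" .
    moreover have "AE s in lborel. s \<in> {0..} \<longrightarrow> (AE x in torus. u s x = v s x)"
      using v(2) by (subst (asm) AE_restrict_space_iff) (auto simp: AE_completion_iff)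
    ultimately have "AE s in lborel. s \<in> {t..t + 1} \<longrightarrow> (AE x in torus. u s x = 0)"
    proof eventually_elim
      case (elim s)
      show ?case
      proof
        assume s: "s \<in> {t..t + 1}"
        then have "AE x in torus. ?T \<le> s \<longrightarrow> v s x = 0" "AE x in torus. u s x = v s x"
          using elim \<open>0 \<le> t\<close> by auto
        then show "AE x in torus. u s x = 0"
          by eventually_elim (use s t in auto)
      qed
    qed
    then show ?thesis
      using sol \<open>0 \<le> t\<close> by (intro C0_L1_zero_from_right[of u t "t + 1"]) (auto simp: is_solution_def)
  qed
  \<comment> \<open>The extinction time vanishes for \<open>u0 = 0\<close>; adding \<open>1\<close> gives a positive time.\<close>
  show ?thesis
  proof (intro conjI exI[of _ "?T + 1"] allI impI)
    show "0 < ?T + 1"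
      using T by simp
  qed (use ext in auto)
qed

end
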